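(* Let $\delta=\delta(s)$ be a unit speed helix in $\mathrm{E}^4$ and let $\xi$ be an involute of $\delta$ (regarded as a regular curve parameterized by its own arclength). Then: 1. $\xi$ cannot be a helix. 2. $\xi$ is a ccr-curve. 3. $\xi$ cannot be a generalized helix. 4. $\xi$ cannot be a 3-type slant helix. 5. $\xi$ cannot lie on a hypersphere of $\mathrm{E}^4$.
   Context: $\mathrm{E}^4$ is $\mathbb{R}^4$ with its standard inner product. A unit speed curve has an orthonormal Frenet-Serret frame $\{T,N,B,E\}$ (tangent, principal normal, binormal, trinormal) and first, second and third curvatures $\kappa,\tau,\sigma$ satisfying $T'=\kappa N$, $N'=-\kappa T+\tau B$, $B'=-\tau N+\sigma E$, $E'=-\sigma B$. A helix (W-curve) in $\mathrm{E}^4$ is a curve whose curvatures $\kappa,\tau,\sigma$ are non-vanishing constants. A ccr-curve is a regular curve whose curvature ratios $\frac{\tau}{\kappa}$ and $\frac{\sigma}{\tau}$ are constant. A curve is a generalized helix if its tangent vector field makes a constant angle with a fixed unit vector $U$. A curve is a 3-type slant helix if its trinormal vector field makes a constant angle with a fixed direction (fixed unit vector) $U$. An involute of the unit speed curve $\delta(s)$ with unit tangent $T$ is a curve $\xi(s)=\delta(s)+(c-s)T(s)$, $c$ constant, considered on parameters $s<c$. *)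

theory Defs
  imports "HOL-Analysis.Analysis"
begin

definition open_interval :: "real set \<Rightarrow> bool" where
  "open_interval I \<longleftrightarrow> open I \<and> is_interval I \<and> I \<noteq> {}"

definition unit_speed :: "(real \<Rightarrow> real ^ 4) \<Rightarrow> real set \<Rightarrow> bool" where
  "unit_speed \<gamma> I \<longleftrightarrow>
     (\<forall>s\<in>I. \<gamma> differentiable (at s) \<and> norm (vector_derivative \<gamma> (at s)) = 1)"

definition orthonormal4 :: "real ^ 4 \<Rightarrow> real ^ 4 \<Rightarrow> real ^ 4 \<Rightarrow> real ^ 4 \<Rightarrow> bool" where
  "orthonormal4 v1 v2 v3 v4 \<longleftrightarrow>
     norm v1 = 1 \<and> norm v2 = 1 \<and> norm v3 = 1 \<and> norm v4 = 1 \<and>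
     v1 \<bullet> v2 = 0 \<and> v1 \<bullet> v3 = 0 \<and> v1 \<bullet> v4 = 0 \<and>
     v2 \<bullet> v3 = 0 \<and> v2 \<bullet> v4 = 0 \<and> v3 \<bullet> v4 = 0"

text \<open>Since \<open>\<kappa>\<close> and \<open>\<tau>\<close> do not vanish, the Frenet-Serret equations determine \<open>N\<close>, \<open>B\<close>, \<open>E\<close>
  up to sign on an interval. No sign is imposed, so this covers the convention
  \<open>\<kappa> > 0\<close>, \<open>\<tau> > 0\<close> as well as any choice of orientation for \<open>E\<close>; the notions below do not
  depend on these choices. The first equation makes the curve unit speed.\<close>

definition frenet_frame ::
  "(real \<Rightarrow> real ^ 4) \<Rightarrow> real set \<Rightarrow>
   (real \<Rightarrow> real ^ 4) \<Rightarrow> (real \<Rightarrow> real ^ 4) \<Rightarrow> (real \<Rightarrow> real ^ 4) \<Rightarrow> (real \<Rightarrow> real ^ 4) \<Rightarrow>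
   (real \<Rightarrow> real) \<Rightarrow> (real \<Rightarrow> real) \<Rightarrow> (real \<Rightarrow> real) \<Rightarrow> bool" where
  "frenet_frame \<gamma> I T N B E \<kappa> \<tau> \<sigma> \<longleftrightarrow>
     (\<forall>s\<in>I.
        (\<gamma> has_vector_derivative T s) (at s) \<and>
        orthonormal4 (T s) (N s) (B s) (E s) \<and>
        \<kappa> s \<noteq> 0 \<and> \<tau> s \<noteq> 0 \<and>
        (T has_vector_derivative \<kappa> s *\<^sub>R N s) (at s) \<and>
        (N has_vector_derivative - (\<kappa> s) *\<^sub>R T s + \<tau> s *\<^sub>R B s) (at s) \<and>
        (B has_vector_derivative - (\<tau> s) *\<^sub>R N s + \<sigma> s *\<^sub>R E s) (at s) \<and>
        (E has_vector_derivative - (\<sigma> s) *\<^sub>R B s) (at s))"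

definition helix :: "(real \<Rightarrow> real ^ 4) \<Rightarrow> real set \<Rightarrow> bool" where
  "helix \<gamma> I \<longleftrightarrow>
     (\<exists>T N B E \<kappa> \<tau> \<sigma> k t u.
        frenet_frame \<gamma> I T N B E \<kappa> \<tau> \<sigma> \<and>
        k \<noteq> 0 \<and> t \<noteq> 0 \<and> u \<noteq> 0 \<and>
        (\<forall>s\<in>I. \<kappa> s = k \<and> \<tau> s = t \<and> \<sigma> s = u))"

definition ccr_curve :: "(real \<Rightarrow> real ^ 4) \<Rightarrow> real set \<Rightarrow> bool" where
  "ccr_curve \<gamma> I \<longleftrightarrow>
     (\<exists>T N B E \<kappa> \<tau> \<sigma> a b.
        frenet_frame \<gamma> I T N B E \<kappa> \<tau> \<sigma> \<and>
        (\<forall>s\<in>I. \<tau> s / \<kappa> s = a \<and> \<sigma> s / \<tau> s = b))"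

text \<open>For a field \<open>V\<close> of unit vectors and a unit vector \<open>U\<close>, \<open>V s \<bullet> U\<close> is the cosine of the
  angle between \<open>V s\<close> and \<open>U\<close>.\<close>

definition constant_angle :: "(real \<Rightarrow> real ^ 4) \<Rightarrow> real set \<Rightarrow> real ^ 4 \<Rightarrow> bool" where
  "constant_angle V I U \<longleftrightarrow> (\<exists>\<theta>\<in>{0..pi}. \<forall>s\<in>I. V s \<bullet> U = cos \<theta>)"

definition generalized_helix :: "(real \<Rightarrow> real ^ 4) \<Rightarrow> real set \<Rightarrow> bool" where
  "generalized_helix \<gamma> I \<longleftrightarrow>
     unit_speed \<gamma> I \<and>
     (\<exists>U. norm U = 1 \<and> constant_angle (\<lambda>s. vector_derivative \<gamma> (at s)) I U)"

definition slant_helix_3 :: "(real \<Rightarrow> real ^ 4) \<Rightarrow> real set \<Rightarrow> bool" where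
  "slant_helix_3 \<gamma> I \<longleftrightarrow>
     (\<exists>T N B E \<kappa> \<tau> \<sigma> U.
        frenet_frame \<gamma> I T N B E \<kappa> \<tau> \<sigma> \<and> norm U = 1 \<and> constant_angle E I U)"

definition lies_on_hypersphere :: "(real \<Rightarrow> real ^ 4) \<Rightarrow> real set \<Rightarrow> bool" where
  "lies_on_hypersphere \<gamma> I \<longleftrightarrow> (\<exists>p r. r > 0 \<and> \<gamma> ` I \<subseteq> sphere p r)"

definition involute :: "(real \<Rightarrow> real ^ 4) \<Rightarrow> real \<Rightarrow> real \<Rightarrow> real ^ 4" where
  "involute \<delta> c s = \<delta> s + (c - s) *\<^sub>R vector_derivative \<delta> (at s)"

text \<open>\<open>\<eta>\<close> on \<open>J\<close> is an orientation-preserving reparametrization of \<open>\<gamma>\<close> on \<open>I\<close> by arclength;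
  it is unique up to a translation of the parameter.\<close>

definition arclength_reparam ::
  "(real \<Rightarrow> real ^ 4) \<Rightarrow> real set \<Rightarrow> (real \<Rightarrow> real ^ 4) \<Rightarrow> real set \<Rightarrow> bool" where
  "arclength_reparam \<gamma> I \<eta> J \<longleftrightarrow>
     open_interval J \<and> unit_speed \<eta> J \<and>
     (\<exists>\<phi>. bij_betw \<phi> J I \<and>
          (\<forall>t\<in>J. \<eta> t = \<gamma> (\<phi> t)) \<and>
          (\<forall>t\<in>J. \<exists>d>0. (\<phi> has_real_derivative d) (at t)))"

end

theory Submission
  imports Defs
begin

text \<open>Let \<open>T, N, B, E\<close> be the frame of the helix \<open>\<delta>\<close>, with constant curvatures \<open>k, t, u\<close>, where
  \<open>k > 0\<close> after a change of signs. Since \<open>T' = k N\<close>, the involute \<open>\<xi> s = \<delta> s + (c - s) T s\<close> has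
  velocity \<open>(c - s) k N s\<close>: its unit tangent is \<open>N\<close>, and an arclength parameter \<open>x\<close> moves along
  the helix at the rate \<open>ds/dx = 1 / (k (c - s))\<close>. Reparametrizing therefore multiplies the
  derivatives of the fields \<open>T, N, B, E\<close> by one common factor, and the involute has the frame
  \<open>N\<close>, \<open>(-k T + t B) / r\<close>, \<open>E\<close>, \<open>(t T + k B) / r\<close> with \<open>r = sqrt (k\<^sup>2 + t\<^sup>2)\<close>; its curvatures are
  constant multiples of \<open>1 / (k (c - s))\<close>. So the curvature ratios are constant
  (\<open>involute_ccr_curve\<close>), while the first curvature is not (\<open>involute_not_helix\<close>).

  The two claims about angles reduce to a rigidity property of the helix itself: a vector \<open>U\<close> for
  which \<open>E \<bullet> U\<close> is constant on a nonempty open set of parameters is zero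
  (\<open>trinormal_angle_constant_imp_zero\<close>), as one sees by differentiating and reading off
  the components of \<open>U\<close> one by one. If the tangent \<open>N\<close> of the involute makes a constant angle with
  \<open>U\<close>, two differentiations make \<open>E \<bullet> U\<close> constant. If the trinormal, which any choice of frame
  determines up to sign as \<open>\<plusminus>(t T + k B) / r\<close>, makes a constant angle with \<open>U\<close>, one differentiation
  gives \<open>E \<bullet> U = 0\<close>. Finally, if the involute lay on a sphere about \<open>p\<close>, then
  differentiating \<open>\<parallel>\<xi> - p\<parallel>\<^sup>2\<close> repeatedly would give both \<open>t u (\<xi> - p) \<bullet> E = k\<close> and \<open>(\<xi> - p) \<bullet> E = 0\<close>.\<close>

section \<open>Derivatives of inner products and orthonormal frames\<close>

lemma has_real_derivative_inner:
  fixes f g :: "real \<Rightarrow> 'a::real_inner"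
  assumes "(f has_vector_derivative f') (at x)" "(g has_vector_derivative g') (at x)"
  shows "((\<lambda>y. f y \<bullet> g y) has_real_derivative (f x \<bullet> g' + f' \<bullet> g x)) (at x)"
  unfolding has_field_derivative_def
  by (rule has_derivative_eq_rhs, rule has_derivative_inner[OF assms[unfolded has_vector_derivative_def]])
    (simp add: fun_eq_iff algebra_simps)

lemma has_real_derivative_inner_const:
  fixes f :: "real \<Rightarrow> 'a::real_inner"
  assumes "(f has_vector_derivative f') (at x)"
  shows "((\<lambda>y. f y \<bullet> U) has_real_derivative (f' \<bullet> U)) (at x)"
  using has_real_derivative_inner[OF assms has_vector_derivative_const] by simp

lemma has_vector_derivative_comp_real:
  assumes "(f has_real_derivative d) (at x)" "(g has_vector_derivative g') (at (f x))"
  shows "(g \<circ> f has_vector_derivative d *\<^sub>R g') (at x)"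
  using vector_diff_chain_at assms has_real_derivative_iff_has_vector_derivative by blast

lemma DERIV_zero_if_constant_on_open:
  fixes f :: "real \<Rightarrow> real"
  assumes "open S" "x \<in> S" "\<And>y. y \<in> S \<Longrightarrow> f y = a" "(f has_real_derivative d) (at x)"
  shows "d = 0"
proof -
  have "((\<lambda>_. a) has_real_derivative d) (at x)"
    by (rule has_field_derivative_transform_within_open[OF assms(4,1,2)]) (use assms(3) in auto)
  then show ?thesis
    using DERIV_const DERIV_unique by blast
qed

lemma has_vector_derivative_unique_on_open:
  assumes "open S" "x \<in> S" "\<And>y. y \<in> S \<Longrightarrow> f y = g y"
    and "(f has_vector_derivative f') (at x)" "(g has_vector_derivative g') (at x)"
  shows "f' = g'"
  using has_vector_derivative_transform_within_open[OF assms(4,1,2,3)] assms(5)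
    vector_derivative_unique_at by blast

lemma orthonormal4_inner:
  assumes "orthonormal4 v1 v2 v3 v4"
  shows "v1 \<bullet> v1 = 1" "v2 \<bullet> v2 = 1" "v3 \<bullet> v3 = 1" "v4 \<bullet> v4 = 1"
    "v1 \<bullet> v2 = 0" "v1 \<bullet> v3 = 0" "v1 \<bullet> v4 = 0" "v2 \<bullet> v3 = 0" "v2 \<bullet> v4 = 0" "v3 \<bullet> v4 = 0"
    "v2 \<bullet> v1 = 0" "v3 \<bullet> v1 = 0" "v4 \<bullet> v1 = 0" "v3 \<bullet> v2 = 0" "v4 \<bullet> v2 = 0" "v4 \<bullet> v3 = 0"
  using assms unfolding orthonormal4_def by (simp_all add: norm_eq_1 inner_commute)

lemma orthonormal4_complete:
  assumes on: "orthonormal4 v1 v2 v3 v4"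
    and "U \<bullet> v1 = 0" "U \<bullet> v2 = 0" "U \<bullet> v3 = 0" "U \<bullet> v4 = 0"
  shows "U = 0"
proof -
  note i = orthonormal4_inner[OF on]
  let ?S = "{v1, v2, v3, v4}"
  have "v1 \<noteq> v2" "v1 \<noteq> v3" "v1 \<noteq> v4" "v2 \<noteq> v3" "v2 \<noteq> v4" "v3 \<noteq> v4"
    using i by force+
  then have card: "card ?S = 4" by simp
  have nz: "0 \<notin> ?S" using i by force
  have "pairwise orthogonal ?S"
    unfolding pairwise_def orthogonal_def using i by auto
  then have ind: "independent ?S"
    using nz pairwise_orthogonal_independent by blast
  have "UNIV \<subseteq> span ?S"
    by (rule card_ge_dim_independent) (use ind card in auto)
  then have "U \<in> span ?S" by blast
  moreover have "\<And>x. x \<in> ?S \<Longrightarrow> orthogonal U x"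
    unfolding orthogonal_def using assms by auto
  ultimately have "orthogonal U U"
    using orthogonal_to_span by blast
  then show ?thesis by (simp add: orthogonal_def)
qed

section \<open>The helix and the frame of its involute\<close>

text \<open>The sign of the curvature of a helix can be absorbed by the frame:
  \<open>(T, -N, -B, -E)\<close> is a frame with curvatures \<open>-k, t, u\<close>.\<close>

lemma helix_positive_curvature:
  assumes "helix \<delta> I"
  obtains T N B E k t u where "frenet_frame \<delta> I T N B E (\<lambda>_. k) (\<lambda>_. t) (\<lambda>_. u)"
    and "k > 0" "t \<noteq> 0" "u \<noteq> 0"
proof -
  obtain T N B E \<kappa> \<tau> \<sigma> k t u where fr: "frenet_frame \<delta> I T N B E \<kappa> \<tau> \<sigma>"
    and nz: "k \<noteq> 0" "t \<noteq> 0" "u \<noteq> 0" and c: "\<forall>s\<in>I. \<kappa> s = k \<and> \<tau> s = t \<and> \<sigma> s = u"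
    using assms unfolding helix_def by blast
  have fr': "frenet_frame \<delta> I T N B E (\<lambda>_. k) (\<lambda>_. t) (\<lambda>_. u)"
    using fr c unfolding frenet_frame_def by simp
  show ?thesis
  proof (cases "k > 0")
    case True
    then show ?thesis using that fr' nz by blast
  next
    case False
    have "frenet_frame \<delta> I T (\<lambda>s. - N s) (\<lambda>s. - B s) (\<lambda>s. - E s) (\<lambda>_. - k) (\<lambda>_. t) (\<lambda>_. u)"
      unfolding frenet_frame_def
    proof (intro ballI conjI)
      fix s assume s: "s \<in> I"
      note f = fr'[unfolded frenet_frame_def, rule_format, OF s]
      show "(T has_vector_derivative - k *\<^sub>R - N s) (at s)" using f by simp
      show "((\<lambda>s. - N s) has_vector_derivative - (- k) *\<^sub>R T s + t *\<^sub>R - B s) (at s)"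
        by (rule has_vector_derivative_eq_rhs, rule has_vector_derivative_minus) (use f in auto)
      show "((\<lambda>s. - B s) has_vector_derivative - t *\<^sub>R - N s + u *\<^sub>R - E s) (at s)"
        by (rule has_vector_derivative_eq_rhs, rule has_vector_derivative_minus) (use f in auto)
      show "((\<lambda>s. - E s) has_vector_derivative - u *\<^sub>R - B s) (at s)"
        by (rule has_vector_derivative_eq_rhs, rule has_vector_derivative_minus) (use f in auto)
    qed (use fr' in \<open>auto simp: frenet_frame_def orthonormal4_def\<close>)
    then show ?thesis using that[of T _ _ _ "- k"] False nz by force
  qed
qed

locale helix_with_involute =
  fixes \<delta> T N B E :: "real \<Rightarrow> real ^ 4" and I :: "real set" and k t u c :: real
  assumes interval: "open_interval I"
    and frame: "frenet_frame \<delta> I T N B E (\<lambda>_. k) (\<lambda>_. t) (\<lambda>_. u)"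
    and k_pos: "k > 0" and t_nz: "t \<noteq> 0" and u_nz: "u \<noteq> 0"
    and nonempty: "I \<inter> {..<c} \<noteq> {}"
begin

abbreviation S :: "real set" where "S \<equiv> I \<inter> {..<c}"

text \<open>The vector \<open>M = N'\<close> has the direction of the principal normal of the involute, and \<open>W\<close>,
  which completes \<open>N, M, E\<close> to an orthogonal basis, that of its trinormal.\<close>

abbreviation M :: "real \<Rightarrow> real ^ 4" where "M s \<equiv> - k *\<^sub>R T s + t *\<^sub>R B s"

abbreviation W :: "real \<Rightarrow> real ^ 4" where "W s \<equiv> t *\<^sub>R T s + k *\<^sub>R B s"

lemma open_S: "open S"
  using interval unfolding open_interval_def by (simp add: open_Int)

lemma frame_derivatives:
  assumes "s \<in> I"
  shows "(\<delta> has_vector_derivative T s) (at s)"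
    "(T has_vector_derivative k *\<^sub>R N s) (at s)"
    "(N has_vector_derivative M s) (at s)"
    "(B has_vector_derivative - t *\<^sub>R N s + u *\<^sub>R E s) (at s)"
    "(E has_vector_derivative - u *\<^sub>R B s) (at s)"
  using frame assms unfolding frenet_frame_def by auto

lemma orthonormal: "s \<in> I \<Longrightarrow> orthonormal4 (T s) (N s) (B s) (E s)"
  using frame unfolding frenet_frame_def by auto

lemmas inner_frame = orthonormal4_inner[OF orthonormal]

lemma M_derivative:
  assumes "s \<in> I"
  shows "(M has_vector_derivative - (k\<^sup>2 + t\<^sup>2) *\<^sub>R N s + (t * u) *\<^sub>R E s) (at s)"
  by (rule has_vector_derivative_eq_rhs)
    (auto intro!: derivative_eq_intros frame_derivatives assms
      simp: algebra_simps power2_eq_square)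

lemma W_derivative:
  assumes "s \<in> I"
  shows "(W has_vector_derivative (k * u) *\<^sub>R E s) (at s)"
  by (rule has_vector_derivative_eq_rhs)
    (auto intro!: derivative_eq_intros frame_derivatives assms simp: algebra_simps)

lemma involute_eq: "s \<in> I \<Longrightarrow> involute \<delta> c s = \<delta> s + (c - s) *\<^sub>R T s"
  unfolding involute_def using frame_derivatives(1)[of s] vector_derivative_at by metis

lemma involute_derivative:
  assumes s: "s \<in> I"
  shows "(involute \<delta> c has_vector_derivative ((c - s) * k) *\<^sub>R N s) (at s)"
proof (rule has_vector_derivative_transform_within_open)
  show "((\<lambda>s. \<delta> s + (c - s) *\<^sub>R T s) has_vector_derivative ((c - s) * k) *\<^sub>R N s) (at s)"
    by (rule has_vector_derivative_eq_rhs)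
      (auto intro!: derivative_eq_intros frame_derivatives s simp: algebra_simps)
  show "open I" using interval unfolding open_interval_def by blast
qed (use s involute_eq in auto)

section \<open>Rigidity of the helix\<close>

text \<open>Differentiating \<open>E \<bullet> U\<close> kills \<open>B \<bullet> U\<close>; the derivative of \<open>B \<bullet> U\<close> then makes \<open>N \<bullet> U\<close> a
  constant multiple of \<open>E \<bullet> U\<close>, hence constant; its derivative kills \<open>T \<bullet> U\<close>, and
  the derivative of \<open>T \<bullet> U\<close> kills \<open>N \<bullet> U\<close> and with it \<open>E \<bullet> U\<close>.\<close>

lemma trinormal_angle_constant_imp_zero:
  assumes const: "\<And>s. s \<in> S \<Longrightarrow> E s \<bullet> U = e"
  shows "U = 0"
proof -
  have BU: "B s \<bullet> U = 0" if "s \<in> S" for s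
    using DERIV_zero_if_constant_on_open[OF open_S that const
        has_real_derivative_inner_const[OF frame_derivatives(5)]] that u_nz by simp
  have NU_eq: "t * (N s \<bullet> U) = u * e" if "s \<in> S" for s
    using DERIV_zero_if_constant_on_open[OF open_S that BU
        has_real_derivative_inner_const[OF frame_derivatives(4)]] that const
    by (simp add: inner_diff_left)
  have NU_const: "N s \<bullet> U = u * e / t" if "s \<in> S" for s
    using NU_eq[OF that] t_nz by (simp add: field_simps)
  have TU: "T s \<bullet> U = 0" if "s \<in> S" for s
    using DERIV_zero_if_constant_on_open[OF open_S that NU_const
        has_real_derivative_inner_const[OF frame_derivatives(3)]] that BU k_pos
    by (simp add: inner_diff_left)
  have NU: "N s \<bullet> U = 0" if "s \<in> S" for s
    using DERIV_zero_if_constant_on_open[OF open_S that TU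
        has_real_derivative_inner_const[OF frame_derivatives(2)]] that k_pos by simp
  obtain s where s: "s \<in> S" using nonempty by blast
  have "e = 0" using NU_eq[OF s] NU[OF s] u_nz by simp
  then show ?thesis
    using orthonormal4_complete[OF orthonormal[of s]] s TU NU BU const by (simp add: inner_commute)
qed

text \<open>Here \<open>M \<bullet> U = 0\<close>, and the derivative of this relation expresses \<open>E \<bullet> U\<close> by the constant
  \<open>N \<bullet> U\<close>.\<close>

lemma principal_normal_angle_constant_imp_zero:
  assumes const: "\<And>s. s \<in> S \<Longrightarrow> N s \<bullet> U = a"
  shows "U = 0"
proof -
  have MU: "M s \<bullet> U = 0" if "s \<in> S" for s
    using DERIV_zero_if_constant_on_open[OF open_S that const
        has_real_derivative_inner_const[OF frame_derivatives(3)]] that by simp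
  have "E s \<bullet> U = (k\<^sup>2 + t\<^sup>2) * a / (t * u)" if "s \<in> S" for s
    using DERIV_zero_if_constant_on_open[OF open_S that MU
        has_real_derivative_inner_const[OF M_derivative]] that const t_nz u_nz
    by (simp add: inner_add_left inner_diff_left field_simps)
  then show ?thesis by (rule trinormal_angle_constant_imp_zero)
qed

text \<open>The square of \<open>W \<bullet> U\<close> is insensitive to the sign of \<open>W\<close>, and this is why it
  occurs here: a trinormal of the involute is parallel to \<open>W\<close> with an undetermined sign.\<close>

lemma W_angle_constant_imp_zero:
  assumes const: "\<And>s. s \<in> S \<Longrightarrow> (W s \<bullet> U)\<^sup>2 = a"
  shows "U = 0"
proof -
  have W: "((\<lambda>s. W s \<bullet> U) has_real_derivative k * u * (E s \<bullet> U)) (at s)" if "s \<in> S" for s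
    using has_real_derivative_inner_const[OF W_derivative, of s U] that by simp
  have "E s \<bullet> U = 0" if s: "s \<in> S" for s
  proof (cases "a = 0")
    case True
    then have "W s \<bullet> U = 0" if "s \<in> S" for s using const[OF that] by simp
    then show ?thesis
      using DERIV_zero_if_constant_on_open[OF open_S s _ W[OF s]] k_pos u_nz by simp
  next
    case False
    then have "W s \<bullet> U \<noteq> 0" using const[OF s] by auto
    moreover have "((\<lambda>s. (W s \<bullet> U)\<^sup>2) has_real_derivative
        2 * (W s \<bullet> U) * (k * u * (E s \<bullet> U))) (at s)"
      using DERIV_power[OF W[OF s], of 2] by (simp add: mult_ac)
    ultimately show ?thesis
      using DERIV_zero_if_constant_on_open[OF open_S s const] k_pos u_nz by fastforce
  qed
  then show ?thesis by (rule trinormal_angle_constant_imp_zero)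
qed

text \<open>With \<open>X = \<xi> - p\<close>, so that \<open>X' = (c - s) k N\<close>, successive derivatives of \<open>\<parallel>X\<parallel>\<^sup>2\<close> give
  \<open>X \<bullet> N = 0\<close>, \<open>X \<bullet> M = - (c - s) k\<close> and \<open>t u (X \<bullet> E) = k\<close>. As \<open>X \<bullet> E\<close> is constant and
  \<open>X'\<close> is orthogonal to \<open>E\<close> and \<open>B\<close>, it follows that \<open>X \<bullet> B = 0\<close> and then \<open>X \<bullet> E = 0\<close>.\<close>

lemma involute_not_on_sphere:
  assumes "involute \<delta> c ` S \<subseteq> sphere p r"
  shows False
proof -
  define X where "X s = involute \<delta> c s - p" for s
  have X: "(X has_vector_derivative ((c - s) * k) *\<^sub>R N s) (at s)" if "s \<in> S" for s
    unfolding X_def[abs_def] using has_vector_derivative_diff[OF involute_derivative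
        has_vector_derivative_const] that by simp
  have XX: "X s \<bullet> X s = r\<^sup>2" if "s \<in> S" for s
    using assms that unfolding X_def
    by (auto simp: dist_norm norm_minus_commute dot_square_norm image_subset_iff)
  have XN: "X s \<bullet> N s = 0" if s: "s \<in> S" for s
    using DERIV_zero_if_constant_on_open[OF open_S s XX
        has_real_derivative_inner[OF X[OF s] X[OF s]]] s k_pos
    by (simp add: inner_commute)
  have XM: "X s \<bullet> M s = - ((c - s) * k)" if s: "s \<in> S" for s
    using DERIV_zero_if_constant_on_open[OF open_S s XN
        has_real_derivative_inner[OF X[OF s] frame_derivatives(3)]] s inner_frame[of s]
    by (simp add: eq_neg_iff_add_eq_0)
  have XE: "X s \<bullet> E s = k / (t * u)" if s: "s \<in> S" for s
  proof -
    have "((\<lambda>s. (c - s) * k) has_real_derivative - k) (at s)"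
      by (auto intro!: derivative_eq_intros)
    from DERIV_add[OF has_real_derivative_inner[OF X[OF s] M_derivative] this]
    have "((\<lambda>s. X s \<bullet> M s + (c - s) * k) has_real_derivative
      X s \<bullet> (- (k\<^sup>2 + t\<^sup>2) *\<^sub>R N s + (t * u) *\<^sub>R E s) + ((c - s) * k) *\<^sub>R N s \<bullet> M s + - k) (at s)"
      using s by blast
    from DERIV_zero_if_constant_on_open[OF open_S s _ this, of 0]
    have "X s \<bullet> (- (k\<^sup>2 + t\<^sup>2) *\<^sub>R N s + (t * u) *\<^sub>R E s) + ((c - s) * k) *\<^sub>R N s \<bullet> M s + - k = 0"
      using XM by simp
    then have "t * u * (X s \<bullet> E s) = k"
      using s inner_frame[of s] XN by (simp add: inner_add_right inner_diff_right)
    then show ?thesis using t_nz u_nz by (simp add: field_simps)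
  qed
  have XB: "X s \<bullet> B s = 0" if s: "s \<in> S" for s
    using DERIV_zero_if_constant_on_open[OF open_S s XE
        has_real_derivative_inner[OF X[OF s] frame_derivatives(5)]] s inner_frame[of s] u_nz
    by simp
  obtain s where s: "s \<in> S" using nonempty by blast
  have "X s \<bullet> E s = 0"
    using DERIV_zero_if_constant_on_open[OF open_S s XB
        has_real_derivative_inner[OF X[OF s] frame_derivatives(4)]] s inner_frame[of s] XN[OF s] u_nz
    by (simp add: inner_add_right inner_diff_right)
  then show False using XE[OF s] k_pos t_nz u_nz by simp
qed

section \<open>Reparametrization by arclength\<close>

text \<open>An antiderivative of the speed \<open>k (c - s)\<close> of the involute is \<open>x = - k (c - s)\<^sup>2 / 2\<close>. It is
  negative for \<open>s < c\<close>, and solving for \<open>s\<close> gives the inverse \<open>s = c - sqrt (- 2 x / k)\<close>.\<close>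

lemma involute_arclength_reparam_exists:
  "\<exists>\<eta> J. arclength_reparam (involute \<delta> c) S \<eta> J"
proof -
  define \<phi> where "\<phi> x = c - sqrt (- 2 * x / k)" for x
  define \<psi> where "\<psi> s = - (k * (c - s)\<^sup>2 / 2)" for s
  define J where "J = \<psi> ` S"
  have \<psi>_neg: "\<psi> s < 0" if "s \<in> S" for s
    using that k_pos unfolding \<psi>_def by simp
  have \<phi>\<psi>: "\<phi> (\<psi> s) = s" if "s \<in> S" for s
    using that k_pos unfolding \<phi>_def \<psi>_def by (simp add: real_sqrt_abs)
  have \<psi>\<phi>: "\<psi> (\<phi> x) = x" if "x < 0" for x
    using that k_pos unfolding \<phi>_def \<psi>_def by (simp add: field_simps)
  have bij: "bij_betw \<phi> J S"
    unfolding J_def by (rule bij_betw_byWitness[where f' = \<psi>]) (use \<phi>\<psi> in auto)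
  have J_eq: "J = {..<0} \<inter> \<phi> -` I"
  proof (intro set_eqI iffI)
    fix x assume "x \<in> {..<0} \<inter> \<phi> -` I"
    moreover have "\<phi> x < c" if "x < 0" using that k_pos unfolding \<phi>_def by (simp add: field_simps)
    ultimately show "x \<in> J" unfolding J_def using \<psi>\<phi>[of x]
      by (auto simp: image_iff intro!: bexI[of _ "\<phi> x"])
  qed (use \<psi>_neg \<phi>\<psi> in \<open>auto simp: J_def\<close>)
  have "continuous_on {..<0} \<phi>"
    unfolding \<phi>_def by (intro continuous_intros) (use k_pos in auto)
  then have "open J"
    unfolding J_eq using interval open_interval_def
    by (intro continuous_open_preimage) auto
  moreover have "is_interval J"
  proof -
    have "is_interval S"
      using interval unfolding open_interval_def by (simp add: is_interval_Int is_interval_io)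
    then have "connected S" using is_interval_connected by blast
    moreover have "continuous_on S \<psi>" unfolding \<psi>_def by (intro continuous_intros) auto
    ultimately show ?thesis
      unfolding J_def is_interval_connected_1 using connected_continuous_image by blast
  qed
  ultimately have J: "open_interval J"
    unfolding open_interval_def J_def using nonempty by blast
  have \<phi>_S: "\<phi> x \<in> S" if "x \<in> J" for x using that bij bij_betwE by blast
  have \<phi>': "(\<phi> has_real_derivative 1 / ((c - \<phi> x) * k)) (at x)" if "x \<in> J" for x
  proof -
    have "- 2 * x / k > 0" using that k_pos J_eq by (auto simp: field_simps)
    then show ?thesis unfolding \<phi>_def using k_pos
      by (auto intro!: derivative_eq_intros simp: field_simps)
  qed
  have speed: "((c - \<phi> x) * k) > 0" if "x \<in> J" for x
    using \<phi>_S[OF that] k_pos by simp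
  have \<eta>': "((involute \<delta> c \<circ> \<phi>) has_vector_derivative N (\<phi> x)) (at x)" if x: "x \<in> J" for x
    using has_vector_derivative_comp_real[OF \<phi>'[OF x] involute_derivative[of "\<phi> x"]]
      \<phi>_S[OF x] speed[OF x] k_pos by simp
  have "unit_speed (involute \<delta> c \<circ> \<phi>) J"
    unfolding unit_speed_def
  proof (intro ballI conjI)
    fix x assume x: "x \<in> J"
    show "(involute \<delta> c \<circ> \<phi>) differentiable (at x)"
      using \<eta>'[OF x] differentiableI_vector by blast
    show "norm (vector_derivative (involute \<delta> c \<circ> \<phi>) (at x)) = 1"
      using vector_derivative_at[OF \<eta>'[OF x]] orthonormal[of "\<phi> x"] \<phi>_S[OF x]
      by (simp add: orthonormal4_def)
  qed
  moreover have "\<exists>d>0. (\<phi> has_real_derivative d) (at x)" if "x \<in> J" for x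
    using \<phi>'[OF that] speed[OF that] zero_less_divide_1_iff by blast
  ultimately have "arclength_reparam (involute \<delta> c) S (involute \<delta> c \<circ> \<phi>) J"
    unfolding arclength_reparam_def using J bij by auto
  then show ?thesis by blast
qed

end

text \<open>The unit speed of \<open>\<eta>\<close> determines the derivative of the change of parameter, whatever
  the starting point of the arclength.\<close>

locale involute_by_arclength = helix_with_involute +
  fixes \<eta> :: "real \<Rightarrow> real ^ 4" and J :: "real set" and \<phi> :: "real \<Rightarrow> real"
  assumes J_interval: "open_interval J" and speed: "unit_speed \<eta> J"
    and bij: "bij_betw \<phi> J S"
    and \<eta>_eq: "\<And>x. x \<in> J \<Longrightarrow> \<eta> x = involute \<delta> c (\<phi> x)"
    and increasing: "\<And>x. x \<in> J \<Longrightarrow> \<exists>d>0. (\<phi> has_real_derivative d) (at x)"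
begin

definition rate :: "real \<Rightarrow> real" where "rate x = 1 / (k * (c - \<phi> x))"

lemma open_J: "open J" and nonempty_J: "J \<noteq> {}"
  using J_interval unfolding open_interval_def by auto

lemma \<phi>_S: "x \<in> J \<Longrightarrow> \<phi> x \<in> S"
  using bij bij_betwE by blast

lemma \<phi>_surj: "s \<in> S \<Longrightarrow> \<exists>x\<in>J. s = \<phi> x"
  using bij unfolding bij_betw_def by blast

lemma rate_pos: "x \<in> J \<Longrightarrow> rate x > 0"
  using \<phi>_S[of x] k_pos unfolding rate_def by simp

lemma \<phi>_derivative: "x \<in> J \<Longrightarrow> (\<phi> has_real_derivative rate x) (at x)"
  and \<eta>_derivative: "x \<in> J \<Longrightarrow> (\<eta> has_vector_derivative N (\<phi> x)) (at x)"
proof -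
  assume x: "x \<in> J"
  have s: "\<phi> x \<in> I" "\<phi> x < c" using \<phi>_S[OF x] by auto
  obtain d where d: "d > 0" "(\<phi> has_real_derivative d) (at x)" using increasing[OF x] by blast
  have "((involute \<delta> c \<circ> \<phi>) has_vector_derivative (d * ((c - \<phi> x) * k)) *\<^sub>R N (\<phi> x)) (at x)"
    using has_vector_derivative_comp_real[OF d(2) involute_derivative[OF s(1)]] by simp
  then have \<eta>': "(\<eta> has_vector_derivative (d * ((c - \<phi> x) * k)) *\<^sub>R N (\<phi> x)) (at x)"
    by (rule has_vector_derivative_transform_within_open[OF _ open_J x]) (simp add: \<eta>_eq)
  have "norm (vector_derivative \<eta> (at x)) = 1" using speed x unfolding unit_speed_def by blast
  then have "d * ((c - \<phi> x) * k) = 1"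
    using vector_derivative_at[OF \<eta>'] orthonormal[OF s(1)] d(1) s(2) k_pos
    by (simp add: orthonormal4_def abs_mult)
  then show "(\<phi> has_real_derivative rate x) (at x)"
    and "(\<eta> has_vector_derivative N (\<phi> x)) (at x)"
    using d \<eta>' nonzero_divide_eq_eq[of "k * (c - \<phi> x)" 1 d] s k_pos unfolding rate_def
    by (simp_all add: mult_ac)
qed

lemma chain:
  assumes "x \<in> J" "(V has_vector_derivative V') (at (\<phi> x))"
  shows "((\<lambda>x. V (\<phi> x)) has_vector_derivative rate x *\<^sub>R V') (at x)"
  using has_vector_derivative_comp_real[OF \<phi>_derivative[OF assms(1)] assms(2)]
  by (simp add: o_def)

text \<open>A frame of the involute is not unique, as the signs of its last three vectors are free.
  What the curve itself determines is the tangent \<open>\<eta>'\<close> and the curvature vector \<open>\<eta>''\<close>, which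
  is the product of first curvature and principal normal.\<close>

lemma frame_tangent:
  assumes "frenet_frame \<eta> J T2 N2 B2 E2 \<kappa> \<tau> \<sigma>" "x \<in> J"
  shows "T2 x = N (\<phi> x)"
  using assms \<eta>_derivative[OF assms(2)] vector_derivative_unique_at
  unfolding frenet_frame_def by blast

lemma frame_normal:
  assumes fr: "frenet_frame \<eta> J T2 N2 B2 E2 \<kappa> \<tau> \<sigma>" and x: "x \<in> J"
  shows "\<kappa> x *\<^sub>R N2 x = rate x *\<^sub>R M (\<phi> x)"
proof (rule has_vector_derivative_unique_on_open[OF open_J x frame_tangent[OF fr]])
  show "(T2 has_vector_derivative \<kappa> x *\<^sub>R N2 x) (at x)"
    using fr x unfolding frenet_frame_def by blast
  show "((\<lambda>x. N (\<phi> x)) has_vector_derivative rate x *\<^sub>R M (\<phi> x)) (at x)"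
    using chain[OF x frame_derivatives(3)] \<phi>_S[OF x] by blast
qed

section \<open>The five properties of the involute\<close>

text \<open>The first curvature has absolute value \<open>sqrt (k\<^sup>2 + t\<^sup>2) / (k (c - \<phi> x))\<close>. If it were constant, \<open>\<phi>\<close>
  would be constant too, but its derivative is positive.\<close>

lemma involute_not_helix: "\<not> helix \<eta> J"
proof
  assume "helix \<eta> J"
  then obtain T2 N2 B2 E2 a t2 u2 where
    fr: "frenet_frame \<eta> J T2 N2 B2 E2 (\<lambda>_. a) (\<lambda>_. t2) (\<lambda>_. u2)" and a: "a > 0"
    using helix_positive_curvature by metis
  have "\<phi> x = c - sqrt (k\<^sup>2 + t\<^sup>2) / (a * k)" if x: "x \<in> J" for x
  proof -
    have s: "\<phi> x \<in> I" "\<phi> x < c" using \<phi>_S[OF x] by auto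
    have "norm (M (\<phi> x)) = sqrt (k\<^sup>2 + t\<^sup>2)"
      unfolding norm_eq_sqrt_inner using inner_frame[OF s(1)]
      by (simp add: inner_add_left inner_add_right inner_diff_left inner_diff_right power2_eq_square)
    moreover have "norm (a *\<^sub>R N2 x) = a"
      using fr x a unfolding frenet_frame_def orthonormal4_def by simp
    ultimately have "a = rate x * sqrt (k\<^sup>2 + t\<^sup>2)"
      using frame_normal[OF fr x] rate_pos[OF x] by (metis abs_of_pos norm_scaleR)
    then show ?thesis using a s k_pos unfolding rate_def by (simp add: field_simps)
  qed
  moreover obtain x where "x \<in> J" using nonempty_J by blast
  ultimately show False
    using DERIV_zero_if_constant_on_open[OF open_J _ _ \<phi>_derivative] rate_pos by fastforce
qed

text \<open>In the frame \<open>N, M / r, E, W / r\<close> all three curvatures are multiples of \<open>rate\<close>, since every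
  derivative carries this factor from the chain rule.\<close>

lemma involute_ccr_curve: "ccr_curve \<eta> J"
proof -
  define r where "r = sqrt (k\<^sup>2 + t\<^sup>2)"
  have r: "r > 0" "r\<^sup>2 = k\<^sup>2 + t\<^sup>2"
    using k_pos unfolding r_def by (simp_all add: add_pos_nonneg)
  have r_mult: "r * r = k * k + t * t" using r(2) by (simp add: power2_eq_square)
  let ?\<kappa> = "\<lambda>x. rate x * r" and ?\<tau> = "\<lambda>x. rate x * (t * u / r)"
    and ?\<sigma> = "\<lambda>x. rate x * (- u * k / r)"
  have "frenet_frame \<eta> J (\<lambda>x. N (\<phi> x)) (\<lambda>x. (1 / r) *\<^sub>R M (\<phi> x)) (\<lambda>x. E (\<phi> x))
     (\<lambda>x. (1 / r) *\<^sub>R W (\<phi> x)) ?\<kappa> ?\<tau> ?\<sigma>"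
    unfolding frenet_frame_def
  proof (intro ballI)
    fix x assume x: "x \<in> J"
    then have s: "\<phi> x \<in> I" using \<phi>_S by blast
    note i = inner_frame[OF s]
    have rate: "rate x > 0" using rate_pos[OF x] .
    have on: "orthonormal4 (N (\<phi> x)) ((1 / r) *\<^sub>R M (\<phi> x)) (E (\<phi> x)) ((1 / r) *\<^sub>R W (\<phi> x))"
      unfolding orthonormal4_def norm_eq_1 using r(1) r_mult k_pos i
      by (simp add: inner_add_left inner_add_right inner_diff_left inner_diff_right
          flip: add_divide_distrib)
    have N': "((\<lambda>x. N (\<phi> x)) has_vector_derivative ?\<kappa> x *\<^sub>R ((1 / r) *\<^sub>R M (\<phi> x))) (at x)"
      using chain[OF x frame_derivatives(3)[OF s]] r(1) by simp
    have "((\<lambda>x. (1 / r) *\<^sub>R M (\<phi> x)) has_vector_derivative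
      (1 / r) *\<^sub>R (rate x *\<^sub>R (- (k\<^sup>2 + t\<^sup>2) *\<^sub>R N (\<phi> x) + (t * u) *\<^sub>R E (\<phi> x)))) (at x)"
      using has_vector_derivative_scaleR[OF DERIV_const chain[OF x M_derivative[OF s]], of "1 / r"]
      by simp
    also have "(1 / r) *\<^sub>R (rate x *\<^sub>R (- (k\<^sup>2 + t\<^sup>2) *\<^sub>R N (\<phi> x) + (t * u) *\<^sub>R E (\<phi> x))) =
      - ?\<kappa> x *\<^sub>R N (\<phi> x) + ?\<tau> x *\<^sub>R E (\<phi> x)"
      using r(1) unfolding r(2)[symmetric] by (simp add: algebra_simps power2_eq_square)
    finally have M': "((\<lambda>x. (1 / r) *\<^sub>R M (\<phi> x)) has_vector_derivative
      - ?\<kappa> x *\<^sub>R N (\<phi> x) + ?\<tau> x *\<^sub>R E (\<phi> x)) (at x)" .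
    have "- ?\<tau> x *\<^sub>R ((1 / r) *\<^sub>R M (\<phi> x)) + ?\<sigma> x *\<^sub>R ((1 / r) *\<^sub>R W (\<phi> x)) =
      (- (rate x * u * ((k * k + t * t) / (r * r)))) *\<^sub>R B (\<phi> x)"
      by (simp add: algebra_simps add_divide_distrib)
    also have "\<dots> = rate x *\<^sub>R (- u *\<^sub>R B (\<phi> x))"
      using r(1) unfolding r_mult[symmetric] by simp
    finally have E': "((\<lambda>x. E (\<phi> x)) has_vector_derivative
      - ?\<tau> x *\<^sub>R ((1 / r) *\<^sub>R M (\<phi> x)) + ?\<sigma> x *\<^sub>R ((1 / r) *\<^sub>R W (\<phi> x))) (at x)"
      using chain[OF x frame_derivatives(5)[OF s]] by simp
    have W': "((\<lambda>x. (1 / r) *\<^sub>R W (\<phi> x)) has_vector_derivative - ?\<sigma> x *\<^sub>R E (\<phi> x)) (at x)"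
      using has_vector_derivative_scaleR[OF DERIV_const chain[OF x W_derivative[OF s]], of "1 / r"]
      by (simp add: mult_ac)
    show "(\<eta> has_vector_derivative N (\<phi> x)) (at x) \<and>
      orthonormal4 (N (\<phi> x)) ((1 / r) *\<^sub>R M (\<phi> x)) (E (\<phi> x)) ((1 / r) *\<^sub>R W (\<phi> x)) \<and>
      ?\<kappa> x \<noteq> 0 \<and> ?\<tau> x \<noteq> 0 \<and>
      ((\<lambda>x. N (\<phi> x)) has_vector_derivative ?\<kappa> x *\<^sub>R ((1 / r) *\<^sub>R M (\<phi> x))) (at x) \<and>
      ((\<lambda>x. (1 / r) *\<^sub>R M (\<phi> x)) has_vector_derivative
        - ?\<kappa> x *\<^sub>R N (\<phi> x) + ?\<tau> x *\<^sub>R E (\<phi> x)) (at x) \<and>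
      ((\<lambda>x. E (\<phi> x)) has_vector_derivative
        - ?\<tau> x *\<^sub>R ((1 / r) *\<^sub>R M (\<phi> x)) + ?\<sigma> x *\<^sub>R ((1 / r) *\<^sub>R W (\<phi> x))) (at x) \<and>
      ((\<lambda>x. (1 / r) *\<^sub>R W (\<phi> x)) has_vector_derivative - ?\<sigma> x *\<^sub>R E (\<phi> x)) (at x)"
      using \<eta>_derivative[OF x] on N' M' E' W' rate r(1) t_nz u_nz by simp
  qed
  moreover have "?\<tau> x / ?\<kappa> x = t * u / r\<^sup>2 \<and> ?\<sigma> x / ?\<tau> x = - k / t" if "x \<in> J" for x
    using rate_pos[OF that] r(1) t_nz u_nz by (simp add: field_simps power2_eq_square)
  ultimately show ?thesis unfolding ccr_curve_def by blast
qed

lemma involute_not_generalized_helix: "\<not> generalized_helix \<eta> J"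
proof
  assume "generalized_helix \<eta> J"
  then obtain U \<theta> where U: "norm U = 1" "\<And>x. x \<in> J \<Longrightarrow> vector_derivative \<eta> (at x) \<bullet> U = cos \<theta>"
    unfolding generalized_helix_def constant_angle_def by blast
  have "N s \<bullet> U = cos \<theta>" if "s \<in> S" for s
    using \<phi>_surj[OF that] U(2) vector_derivative_at[OF \<eta>_derivative] by force
  then have "U = 0" by (rule principal_normal_angle_constant_imp_zero)
  then show False using U(1) by simp
qed

text \<open>A trinormal \<open>E2\<close> of the involute is orthogonal to the derivatives of \<open>\<eta>\<close> up to
  order three, hence to \<open>N\<close>, \<open>M\<close> and \<open>E\<close>. This leaves a multiple of \<open>W\<close>, which has
  norm \<open>sqrt (k\<^sup>2 + t\<^sup>2)\<close>.\<close>

lemma trinormal_parallel_W: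
  assumes fr: "frenet_frame \<eta> J T2 N2 B2 E2 \<kappa> \<tau> \<sigma>" and x: "x \<in> J"
  obtains m where "E2 x = m *\<^sub>R W (\<phi> x)" "m\<^sup>2 * (k\<^sup>2 + t\<^sup>2) = 1"
proof -
  have s: "\<phi> x \<in> I" using \<phi>_S x by blast
  note i = inner_frame[OF s]
  have on2: "orthonormal4 (T2 y) (N2 y) (B2 y) (E2 y)" if "y \<in> J" for y
    using fr that unfolding frenet_frame_def by blast
  note i2 = orthonormal4_inner[OF on2]
  have M_eq: "M (\<phi> y) = (\<kappa> y / rate y) *\<^sub>R N2 y" if "y \<in> J" for y
  proof -
    have "(1 / rate y) *\<^sub>R (\<kappa> y *\<^sub>R N2 y) = M (\<phi> y)"
      unfolding frame_normal[OF fr that] using rate_pos[OF that] by simp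
    then show ?thesis by simp
  qed
  have EN: "E2 x \<bullet> N (\<phi> x) = 0"
    using frame_tangent[OF fr x] i2[OF x] by simp
  have EM: "E2 y \<bullet> M (\<phi> y) = 0" if "y \<in> J" for y
    unfolding M_eq[OF that] using i2[OF that] by simp
  have BM: "B2 x \<bullet> M (\<phi> x) = 0"
    unfolding M_eq[OF x] using i2[OF x] by simp
  have E2': "(E2 has_vector_derivative - \<sigma> x *\<^sub>R B2 x) (at x)"
    using fr x unfolding frenet_frame_def by blast
  have "E2 x \<bullet> (rate x *\<^sub>R (- (k\<^sup>2 + t\<^sup>2) *\<^sub>R N (\<phi> x) + (t * u) *\<^sub>R E (\<phi> x)))
      + (- \<sigma> x *\<^sub>R B2 x) \<bullet> M (\<phi> x) = 0"
    by (rule DERIV_zero_if_constant_on_open[OF open_J x EM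
          has_real_derivative_inner[OF E2' chain[OF x M_derivative[OF s]]]])
  moreover have "(- \<sigma> x *\<^sub>R B2 x) \<bullet> M (\<phi> x) = 0"
    unfolding inner_scaleR_left BM by simp
  ultimately have "E2 x \<bullet> (rate x *\<^sub>R (- (k\<^sup>2 + t\<^sup>2) *\<^sub>R N (\<phi> x) + (t * u) *\<^sub>R E (\<phi> x))) = 0"
    by linarith
  then have EE: "E2 x \<bullet> E (\<phi> x) = 0"
    using EN rate_pos[OF x] t_nz u_nz by (simp add: inner_add_right inner_diff_right)
  define m where "m = E2 x \<bullet> B (\<phi> x) / k"
  have mB: "E2 x \<bullet> B (\<phi> x) = m * k" using k_pos unfolding m_def by simp
  have mT: "E2 x \<bullet> T (\<phi> x) = m * t"
    using EM[OF x] k_pos unfolding m_def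
    by (simp add: inner_add_right inner_diff_right field_simps)
  have "E2 x - m *\<^sub>R W (\<phi> x) = 0"
    by (rule orthonormal4_complete[OF orthonormal[OF s]])
      (use mT mB EN EE i in \<open>simp_all add: inner_diff_left inner_add_left\<close>)
  then have E2: "E2 x = m *\<^sub>R W (\<phi> x)" by simp
  have "E2 x \<bullet> E2 x = m\<^sup>2 * (k\<^sup>2 + t\<^sup>2)"
    unfolding E2 using i
    by (simp add: inner_add_left inner_add_right power2_eq_square algebra_simps)
  then have "m\<^sup>2 * (k\<^sup>2 + t\<^sup>2) = 1" unfolding i2(4)[OF x] by simp
  with E2 show ?thesis by (rule that)
qed

lemma involute_not_slant_helix_3: "\<not> slant_helix_3 \<eta> J"
proof
  assume "slant_helix_3 \<eta> J"
  then obtain T2 N2 B2 E2 \<kappa> \<tau> \<sigma> U \<theta> where fr: "frenet_frame \<eta> J T2 N2 B2 E2 \<kappa> \<tau> \<sigma>"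
    and U: "norm U = 1" "\<And>x. x \<in> J \<Longrightarrow> E2 x \<bullet> U = cos \<theta>"
    unfolding slant_helix_3_def constant_angle_def by blast
  have "(W s \<bullet> U)\<^sup>2 = (k\<^sup>2 + t\<^sup>2) * (cos \<theta>)\<^sup>2" if "s \<in> S" for s
  proof -
    obtain x where x: "x \<in> J" "s = \<phi> x" using \<phi>_surj \<open>s \<in> S\<close> by blast
    obtain m where m: "E2 x = m *\<^sub>R W (\<phi> x)" "m\<^sup>2 * (k\<^sup>2 + t\<^sup>2) = 1"
      using trinormal_parallel_W[OF fr x(1)] by blast
    have "cos \<theta> = m * (W s \<bullet> U)" using U(2)[OF x(1)] m(1) x(2) by simp
    then have "(k\<^sup>2 + t\<^sup>2) * (cos \<theta>)\<^sup>2 = (m\<^sup>2 * (k\<^sup>2 + t\<^sup>2)) * (W s \<bullet> U)\<^sup>2"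
      by (simp only: power_mult_distrib mult_ac)
    then show ?thesis using m(2) by simp
  qed
  then have "U = 0" by (rule W_angle_constant_imp_zero)
  then show False using U(1) by simp
qed

lemma involute_not_on_hypersphere: "\<not> lies_on_hypersphere \<eta> J"
proof
  assume "lies_on_hypersphere \<eta> J"
  then obtain p r where "\<eta> ` J \<subseteq> sphere p r" unfolding lies_on_hypersphere_def by blast
  then have "involute \<delta> c ` S \<subseteq> sphere p r"
    using \<phi>_surj \<eta>_eq by (fastforce simp: image_subset_iff)
  then show False by (rule involute_not_on_sphere)
qed

end

theorem theorem5p2:
  fixes \<delta> :: "real \<Rightarrow> real ^ 4" and I :: "real set" and c :: real
  assumes "open_interval I"
    and "unit_speed \<delta> I"
    and "helix \<delta> I"
    and "I \<inter> {..<c} \<noteq> {}"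
  shows "(\<exists>\<eta> J. arclength_reparam (involute \<delta> c) (I \<inter> {..<c}) \<eta> J) \<and>
    (\<forall>\<eta> J. arclength_reparam (involute \<delta> c) (I \<inter> {..<c}) \<eta> J \<longrightarrow>
       \<not> helix \<eta> J \<and>
       ccr_curve \<eta> J \<and>
       \<not> generalized_helix \<eta> J \<and>
       \<not> slant_helix_3 \<eta> J \<and>
       \<not> lies_on_hypersphere \<eta> J)"
proof -
  obtain T N B E k t u where "frenet_frame \<delta> I T N B E (\<lambda>_. k) (\<lambda>_. t) (\<lambda>_. u)"
    and "k > 0" "t \<noteq> 0" "u \<noteq> 0"
    using helix_positive_curvature[OF assms(3)] by metis
  then have H: "helix_with_involute \<delta> T N B E I k t u c"
    using assms(1,4) by unfold_locales
  have "\<not> helix \<eta> J \<and> ccr_curve \<eta> J \<and> \<not> generalized_helix \<eta> J \<and> \<not> slant_helix_3 \<eta> J \<and>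
      \<not> lies_on_hypersphere \<eta> J"
    if reparam: "arclength_reparam (involute \<delta> c) (I \<inter> {..<c}) \<eta> J" for \<eta> J
  proof -
    obtain \<phi> where "involute_by_arclength \<delta> T N B E I k t u c \<eta> J \<phi>"
      using reparam H unfolding arclength_reparam_def
        involute_by_arclength_def involute_by_arclength_axioms_def by blast
    then interpret involute_by_arclength \<delta> T N B E I k t u c \<eta> J \<phi> .
    show ?thesis
      using involute_not_helix involute_ccr_curve involute_not_generalized_helix
        involute_not_slant_helix_3 involute_not_on_hypersphere by blast
  qed
  then show ?thesis
    using helix_with_involute.involute_arclength_reparam_exists[OF H] by blast
qed

end
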